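(* Let $a_{11},a_{21},a_{12},a_{22},a_{32}$ be integers with $0\le a_{11}<a_{21}$, $0\le a_{12}<a_{32}$, $0\le a_{22}<a_{32}$, and let $v=(a_{13},a_{23},a_{33})\in\mathbb{Z}^3$ be such that the matrix $(a_{ij})$ with $a_{31}=0$ has determinant $1$. For $(m,n)\in\mathbb{Z}^2$ let $$H^v_\Omega(m,n)=\begin{pmatrix} a_{11}&a_{12}&a_{11}m+a_{12}n+a_{13}\\ a_{21}&a_{22}&a_{21}m+a_{22}n+a_{23}\\ 0&a_{32}&a_{32}n+a_{33}\end{pmatrix}\in SL(3,\mathbb{Z}).$$ Call a matrix an NRS-matrix if it has one real and two non-real complex conjugate eigenvalues. Let $(m,n)\in\mathbb{Z}^2$ and suppose either (1) $H^v_\Omega(m-t,n)$ is an NRS-matrix for every integer $t\ge0$, or (2) $H^v_\Omega(m+a_{11}t,n+a_{21}t)$ is an NRS-matrix for every integer $t\ge0$ (an NRS-ray). Then, in the corresponding family $\{M_t\}_{t\ge 0}$ (with $M_t=H^v_\Omega(m-t,n)$ in case (1), $M_t=H^v_\Omega(m+a_{11}t,n+a_{21}t)$ in case (2)): (i) only finitely many $M_t$ are $\varsigma$-nonreduced; (ii) only finitely many $M_t$ are integer conjugate to more than one $\varsigma$-reduced matrix.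
   Context: A matrix in $SL(3,\mathbb{Z})$ of the form $(a_{ij})$ with $a_{31}=0$ is an (upper) Hessenberg matrix; it is perfect if $0\le a_{11}<a_{21}$, $0\le a_{12}<a_{32}$, $0\le a_{22}<a_{32}$. Its Hessenberg complexity is $\varsigma(M)=a_{21}^2a_{32}$ (the volume of the parallelepiped spanned by $e=(1,0,0)$, $Me$, $M^2e$). Two matrices $M_1,M_2$ are integer conjugate if $M_2=XM_1X^{-1}$ for some $X\in GL(3,\mathbb{Z})$. A perfect Hessenberg matrix $M$ is $\varsigma$-reduced if its Hessenberg complexity is the least among all perfect Hessenberg matrices integer conjugate to $M$; otherwise it is $\varsigma$-nonreduced. *)

theory Defs
  imports "HOL-Analysis.Analysis"
begin

definition hessenberg :: "int^3^3 \<Rightarrow> bool" where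
  "hessenberg A \<longleftrightarrow> det A = 1 \<and> A $ 3 $ 1 = 0"

definition perfect_hessenberg :: "int^3^3 \<Rightarrow> bool" where
  "perfect_hessenberg A \<longleftrightarrow> hessenberg A \<and>
     0 \<le> A $ 1 $ 1 \<and> A $ 1 $ 1 < A $ 2 $ 1 \<and>
     0 \<le> A $ 1 $ 2 \<and> A $ 1 $ 2 < A $ 3 $ 2 \<and>
     0 \<le> A $ 2 $ 2 \<and> A $ 2 $ 2 < A $ 3 $ 2"

definition hessenberg_complexity :: "int^3^3 \<Rightarrow> int" where
  "hessenberg_complexity A = (A $ 2 $ 1)\<^sup>2 * A $ 3 $ 2"

text \<open>Over the integers, \<^const>\<open>invertible\<close> means having a two-sided inverse with integer
  entries, so \<open>X\<close> below ranges over \<open>GL(3,\<int>)\<close>.\<close>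

definition integer_conjugate :: "int^3^3 \<Rightarrow> int^3^3 \<Rightarrow> bool" where
  "integer_conjugate A B \<longleftrightarrow> (\<exists>X. invertible X \<and> B = X ** A ** matrix_inv X)"

definition sigma_reduced :: "int^3^3 \<Rightarrow> bool" where
  "sigma_reduced A \<longleftrightarrow> perfect_hessenberg A \<and>
     (\<forall>B. perfect_hessenberg B \<and> integer_conjugate A B \<longrightarrow>
        hessenberg_complexity A \<le> hessenberg_complexity B)"

definition sigma_nonreduced :: "int^3^3 \<Rightarrow> bool" where
  "sigma_nonreduced A \<longleftrightarrow> perfect_hessenberg A \<and> \<not> sigma_reduced A"

definition complex_eigenvalue :: "int^3^3 \<Rightarrow> complex \<Rightarrow> bool" where
  "complex_eigenvalue A c \<longleftrightarrow>
     (\<exists>v. v \<noteq> 0 \<and> map_matrix complex_of_int A *v v = c *s v)"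

definition NRS :: "int^3^3 \<Rightarrow> bool" where
  "NRS A \<longleftrightarrow> (\<exists>r z. r \<in> \<real> \<and> z \<notin> \<real> \<and> {c. complex_eigenvalue A c} = {r, z, cnj z})"

definition hess_mat ::
  "int \<Rightarrow> int \<Rightarrow> int \<Rightarrow> int \<Rightarrow> int \<Rightarrow> int \<Rightarrow> int \<Rightarrow> int \<Rightarrow> int^3^3" where
  "hess_mat a11 a12 a13 a21 a22 a23 a32 a33 =
     vector [vector [a11, a12, a13],
             vector [a21, a22, a23],
             vector [0,   a32, a33]]"

text \<open>The third column is shifted by \<open>m\<close> times the first plus \<open>n\<close> times the second column.\<close>

definition hess_family ::
  "int \<Rightarrow> int \<Rightarrow> int \<Rightarrow> int \<Rightarrow> int \<Rightarrow> int \<Rightarrow> int \<Rightarrow> int \<Rightarrow> int \<Rightarrow> int \<Rightarrow> int^3^3" where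
  "hess_family a11 a12 a13 a21 a22 a23 a32 a33 m n =
     hess_mat a11 a12 (a11 * m + a12 * n + a13)
              a21 a22 (a21 * m + a22 * n + a23)
                  a32 (a32 * n + a33)"

end

theory Submission
  imports Defs
begin

text \<open>
  If \<open>B = X A X\<inverse>\<close> is Hessenberg and \<open>w = X\<inverse> e\<^sub>1\<close>, then the complexity of \<open>B\<close> is
  \<open>\<bar>det (w, A w, A\<^sup>2 w)\<bar>\<close>. Expressing \<open>w\<close> in the basis \<open>e\<^sub>1, A e\<^sub>1, A\<^sup>2 e\<^sub>1\<close>, whose index \<open>D\<close> is the
  complexity of \<open>A\<close>, turns this determinant into \<open>D\<close> times the norm of \<open>x + y \<lambda> + z \<lambda>\<^sup>2\<close>, where
  \<open>x, y, z \<in> (1/D)\<int>\<close> and \<open>\<lambda>\<close> is a root of the characteristic polynomial. Along the first ray this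
  polynomial is \<open>X\<^sup>3 - \<tau> X\<^sup>2 + s X - 1\<close> with \<open>\<tau>\<close> fixed and \<open>s \<rightarrow> \<infinity>\<close>: it has one root
  \<open>\<epsilon> \<approx> 1/s\<close> and a conjugate pair of squared modulus \<open>c = 1/\<epsilon>\<close>. Multiplication by powers of
  \<open>\<lambda>\<close>, i.e. replacing \<open>w\<close> by \<open>A\<^sup>k w\<close>, brings the complex factor of the norm into a fixed window
  \<open>[\<delta>, \<delta> c)\<close>. If the norm is at most \<open>1\<close>, then for large \<open>s\<close> the denominator bound forces
  \<open>y = z = 0\<close>, so \<open>w = \<plusminus>A\<^sup>k e\<^sub>1\<close> and \<open>B = A\<close>. Hence \<open>A\<close> is eventually the unique reduced matrix in its
  class. On the second ray the same argument applies to \<open>A\<inverse>\<close> and the basis generated by \<open>A\<^sup>2 e\<^sub>1\<close>.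
\<close>

section \<open>Characteristic coefficients, adjugates and Krylov matrices\<close>

definition trace3 :: "'a::comm_ring_1^3^3 \<Rightarrow> 'a" where
  "trace3 A = A$1$1 + A$2$2 + A$3$3"

text \<open>The sum of the principal 2x2 minors, i.e. the coefficient of X in the characteristic
  polynomial.\<close>

definition minors3 :: "'a::comm_ring_1^3^3 \<Rightarrow> 'a" where
  "minors3 A = A$1$1 * A$2$2 - A$1$2 * A$2$1 + A$1$1 * A$3$3 - A$1$3 * A$3$1
     + A$2$2 * A$3$3 - A$2$3 * A$3$2"

definition adj3 :: "'a::comm_ring_1^3^3 \<Rightarrow> 'a^3^3" where
  "adj3 A = vector
    [vector [A$2$2 * A$3$3 - A$2$3 * A$3$2, A$1$3 * A$3$2 - A$1$2 * A$3$3, A$1$2 * A$2$3 - A$1$3 * A$2$2],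
     vector [A$2$3 * A$3$1 - A$2$1 * A$3$3, A$1$1 * A$3$3 - A$1$3 * A$3$1, A$1$3 * A$2$1 - A$1$1 * A$2$3],
     vector [A$2$1 * A$3$2 - A$2$2 * A$3$1, A$1$2 * A$3$1 - A$1$1 * A$3$2, A$1$1 * A$2$2 - A$1$2 * A$2$1]]"

text \<open>The transpose turns the rows listed by \<open>vector\<close> into the columns w, Aw, A^2
  w.\<close>

definition krylov :: "'a::comm_ring_1^3^3 \<Rightarrow> 'a^3 \<Rightarrow> 'a^3^3" where
  "krylov A w = transpose (vector [w, A *v w, A *v (A *v w)])"

text \<open>Multiplication by X on Z[X]/(X^3 - \<tau> X^2 + s X - 1) in the basis 1, X, X^2.\<close>

definition companion3 :: "'a::comm_ring_1 \<Rightarrow> 'a \<Rightarrow> 'a^3^3" where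
  "companion3 \<tau> s = vector [vector [0, 0, 1], vector [1, 0, - s], vector [0, 1, \<tau>]]"

lemmas mat3_simps = vec_eq_iff forall_3 sum_3 vector_3 matrix_matrix_mult_def
  matrix_vector_mult_def mat_def transpose_def

lemma matrix_vector_mult_smult3:
  fixes A :: "'a::comm_ring_1^3^3"
  shows "A *v (d *s u) = d *s (A *v u)"
  by (simp add: mat3_simps algebra_simps)

lemma mult_adj3:
  fixes A :: "'a::comm_ring_1^3^3"
  shows "A *v (adj3 A *v w) = det A *s w" "adj3 A *v (A *v w) = det A *s w"
  by (simp_all add: mat3_simps adj3_def det_3) (simp_all add: algebra_simps)

lemma adj3_inverse:
  fixes A :: "'a::comm_ring_1^3^3"
  assumes "det A = 1"
  shows "A ** adj3 A = mat 1" "adj3 A ** A = mat 1"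
  using mult_adj3[of A] assms by (simp_all add: matrix_eq matrix_vector_mul_assoc[symmetric])

text \<open>With the next lemma: for determinant 1, inversion swaps the two middle characteristic
  coefficients. This lets the second ray be treated like the first.\<close>

lemma trace3_adj3: "trace3 (adj3 A) = minors3 (A :: 'a::comm_ring_1^3^3)"
  by (simp add: trace3_def adj3_def minors3_def)

lemma minors3_adj3: "minors3 (adj3 A) = det A * trace3 (A :: 'a::comm_ring_1^3^3)"
  by (simp add: trace3_def adj3_def minors3_def det_3 algebra_simps)

lemma cayley_hamilton3:
  fixes A :: "'a::comm_ring_1^3^3"
  shows "A *v (A *v (A *v w)) = det A *s w - minors3 A *s (A *v w) + trace3 A *s (A *v (A *v w))"
proof -
  have "A ** (A ** A) = (\<chi> i j. det A * (mat 1 :: 'a^3^3)$i$j - minors3 A * A$i$j + trace3 A * (A ** A)$i$j)"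
    by (simp add: mat3_simps trace3_def minors3_def det_3) (simp add: algebra_simps)
  moreover have "\<dots> *v w = det A *s w - minors3 A *s (A *v w) + trace3 A *s ((A ** A) *v w)"
    by (simp add: vec_eq_iff forall_3 sum_3 matrix_vector_mult_def mat_def) (simp add: algebra_simps)
  ultimately have "(A ** (A ** A)) *v w = det A *s w - minors3 A *s (A *v w) + trace3 A *s ((A ** A) *v w)"
    by simp
  then show ?thesis by (simp add: matrix_vector_mul_assoc[symmetric])
qed

lemma mult_columns3:
  fixes A :: "'a::comm_ring_1^3^3"
  shows "A ** transpose (vector [f, g, h] :: 'a^3^3) = transpose (vector [A *v f, A *v g, A *v h])"
  by (simp add: mat3_simps)

lemma columns3_mult_companion3:
  fixes f g h :: "'a::comm_ring_1^3"
  shows "transpose (vector [f, g, h] :: 'a^3^3) ** companion3 \<tau> s = transpose (vector [g, h, f - s *s g + \<tau> *s h])"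
  by (simp add: mat3_simps companion3_def mult.commute)

lemma krylov_intertwine:
  fixes A :: "'a::comm_ring_1^3^3"
  assumes "A ** P = P ** B"
  shows "krylov A (P *v w) = P ** krylov B w"
proof -
  have "A *v (P *v u) = P *v (B *v u)" for u
    using assms by (simp add: matrix_vector_mul_assoc)
  then show ?thesis
    by (simp add: krylov_def mult_columns3)
qed

lemma krylov_companion3:
  fixes A :: "'a::comm_ring_1^3^3"
  assumes "det A = 1"
  shows "A ** krylov A f = krylov A f ** companion3 (trace3 A) (minors3 A)"
  unfolding krylov_def mult_columns3 columns3_mult_companion3 cayley_hamilton3[of A f] assms by simp

lemma det_krylov_mult:
  fixes A :: "'a::comm_ring_1^3^3"
  shows "det (krylov A (A *v w)) = det A * det (krylov A w)"
  by (simp add: krylov_intertwine det_mul)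

text \<open>Read backwards, the triple w, A'w, A'^2 w is the Krylov triple of A at A'^2 w; swapping
  the outer columns gives the sign.\<close>

lemma det_krylov_inverse:
  fixes A :: "'a::comm_ring_1^3^3"
  assumes "det A = 1" "A ** A' = mat 1"
  shows "det (krylov A' w) = - det (krylov A w)"
proof -
  define u where "u = A' *v w"
  define v where "v = A' *v u"
  have w: "w = A *v u" and u: "u = A *v v"
    using assms(2) by (simp_all add: u_def v_def matrix_vector_mul_assoc matrix_mul_assoc)
  have "det (krylov A w) = det (krylov A v)"
    unfolding w u using assms(1) by (simp add: det_krylov_mult)
  moreover have "krylov A v = transpose (vector [v, u, w])"
    by (simp add: krylov_def w u)
  moreover have "krylov A' w = transpose (vector [w, u, v])"
    by (simp add: krylov_def u_def v_def)
  ultimately show ?thesis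
    by (simp add: det_3 transpose_def)
qed

lemma det_krylov_scale:
  fixes A :: "'a::comm_ring_1^3^3"
  shows "det (krylov A (d *s w)) = d ^ 3 * det (krylov A w)"
  by (simp add: krylov_def matrix_vector_mult_smult3 det_3 transpose_def power3_eq_cube)
    (simp add: algebra_simps)

section \<open>The norm form and its two real factors\<close>

text \<open>The two real factors of the norm of \<open>v\<^sub>1 + v\<^sub>2 \<lambda> + v\<^sub>3 \<lambda>\<^sup>2\<close> for a cubic that splits as
  \<open>(X - \<epsilon>) (X\<^sup>2 - b X + c)\<close>.\<close>

definition real_factor :: "real \<Rightarrow> int^3 \<Rightarrow> real" where
  "real_factor \<epsilon> v = of_int (v$1) + of_int (v$2) * \<epsilon> + of_int (v$3) * \<epsilon>\<^sup>2"

definition quad_factor :: "real \<Rightarrow> real \<Rightarrow> int^3 \<Rightarrow> real" where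
  "quad_factor b c v = 
    (let u = of_int (v$1) - c * of_int (v$3); w = of_int (v$2) + b * of_int (v$3) in u\<^sup>2 + b * u * w + c * w\<^sup>2)"

lemma companion3_mult:
  "companion3 \<tau> s *v v = vector [v$3, v$1 - s * v$3, v$2 + \<tau> * v$3]"
  by (simp add: mat3_simps companion3_def)

lemma det_companion3: "det (companion3 \<tau> s) = 1"
  by (simp add: companion3_def det_3)

text \<open>The hypotheses are Vieta's relations for (X - \<epsilon>)(X^2 - bX + c). Modulo the
  quadratic, multiplication by X sends u + wX to -cw + (u + bw)X, and the norm of X is c.\<close>

lemma quad_factor_companion3:
  fixes b c \<epsilon> :: real
  assumes "real_of_int \<tau> = b + \<epsilon>" "real_of_int s = c + \<epsilon> * b" "c * \<epsilon> = 1"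
  shows "quad_factor b c (companion3 \<tau> s *v v) = c * quad_factor b c v"
proof -
  let ?u = "v$1 - c * v$3" and ?w = "v$2 + b * v$3"
  have 1: "v$3 - c * (v$2 + (b + \<epsilon>) * v$3) = - c * ?w"
    using assms(3) by algebra
  have 2: "v$1 - (c + \<epsilon> * b) * v$3 + b * (v$2 + (b + \<epsilon>) * v$3) = ?u + b * ?w"
    by (simp add: algebra_simps)
  show ?thesis
    unfolding quad_factor_def companion3_mult Let_def vector_3
    by (simp only: of_int_add of_int_diff of_int_mult assms(1,2) 1 2)
       (simp add: power2_eq_square algebra_simps)
qed

text \<open>The columns v, Xv, X^2 v form the matrix of multiplication by v, so the determinant is
  the norm of v.\<close>

lemma det_krylov_companion3:
  fixes b c \<epsilon> :: real
  assumes "real_of_int \<tau> = b + \<epsilon>" "real_of_int s = c + \<epsilon> * b" "c * \<epsilon> = 1"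
  shows "real_of_int (det (krylov (companion3 \<tau> s) v)) = real_factor \<epsilon> v * quad_factor b c v"
  unfolding krylov_def companion3_mult
  by (simp add: det_3 transpose_def real_factor_def quad_factor_def Let_def assms(1,2))
    (use assms(3) in algebra)


text \<open>A small quadratic factor bounds u and w below. The real factor then bounds the third
  coordinate below 1 in absolute value, and integrality finishes.\<close>

lemma factors_small_imp:
  fixes b c \<epsilon> B K :: real
  assumes \<epsilon>: "0 < \<epsilon>" "\<epsilon> \<le> 1" and b: "\<bar>b\<bar> \<le> B" "B\<^sup>2 \<le> 2 * c" and c: "K + 2 * B + 1 < 3 / 4 * c"
    and K: "\<bar>real_factor \<epsilon> v\<bar> \<le> K" and Q: "quad_factor b c v < c / 32"
  shows "v$2 = 0 \<and> v$3 = 0"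
proof -
  define x y z :: real where "x = v$1" and "y = v$2" and "z = v$3"
  define u where "u = x - c * z"
  define w where "w = y + b * z"
  have B: "0 \<le> B" "0 \<le> K" using b K by auto
  have c1: "1 \<le> c" using c B by simp
  have "b\<^sup>2 \<le> B\<^sup>2"
    using b(1) by (simp add: abs_le_square_iff[symmetric])
  \<comment> \<open>Completing the square leaves the coefficient c - b^2/4, which is at least c/2
    because b^2 is at most 2c.\<close>
  then have "c / 2 * w\<^sup>2 \<le> (c - b\<^sup>2 / 4) * w\<^sup>2"
    using b(2) by (intro mult_right_mono) auto
  moreover have "quad_factor b c v = (u + b * w / 2)\<^sup>2 + (c - b\<^sup>2 / 4) * w\<^sup>2"
    by (simp add: quad_factor_def Let_def u_def w_def x_def y_def z_def power2_eq_square algebra_simps)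
  ultimately have 1: "(u + b * w / 2)\<^sup>2 + c / 2 * w\<^sup>2 < c / 32"
    using Q by linarith
  then have "c * w\<^sup>2 < c * (1 / 16)"
    using zero_le_power2[of "u + b * w / 2"] by linarith
  then have "w\<^sup>2 < (1 / 4)\<^sup>2"
    using c1 by (subst (asm) mult_less_cancel_left_pos) (auto simp: power2_eq_square)
  then have w: "\<bar>w\<bar> < 1 / 4"
    by (metis abs_of_nonneg power2_abs power2_less_imp_less zero_le_divide_1_iff zero_le_numeral)
  have "0 \<le> c / 2 * w\<^sup>2" using c1 by simp
  with 1 have "(u + b * w / 2)\<^sup>2 < c / 32" by linarith
  also have "\<dots> \<le> c * c / 16" using c1 mult_left_mono[of 1 c c] by simp
  finally have "(u + b * w / 2)\<^sup>2 < (c / 4)\<^sup>2" by (simp add: power2_eq_square)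
  then have "\<bar>u + b * w / 2\<bar> < c / 4"
    using c1 by (metis abs_of_nonneg power2_abs power2_less_imp_less divide_nonneg_nonneg zero_le_numeral
        order_trans zero_le_one)
  moreover have "\<bar>b * w\<bar> \<le> B * (1 / 4)"
    unfolding abs_mult using b w B by (intro mult_mono) auto
  ultimately have u: "\<bar>u\<bar> \<le> c / 4 + B / 8" by linarith
  have "\<bar>w * \<epsilon>\<bar> \<le> 1 / 4 * 1"
    unfolding abs_mult using \<epsilon> w by (intro mult_mono) auto
  \<comment> \<open>The coefficient of z is the quadratic cofactor evaluated at \<epsilon>; it is
    about c, hence large.\<close>
  moreover have "real_factor \<epsilon> v = u + w * \<epsilon> + z * (c - b * \<epsilon> + \<epsilon>\<^sup>2)"
    by (simp add: real_factor_def u_def w_def x_def y_def z_def algebra_simps)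
  ultimately have z: "\<bar>z * (c - b * \<epsilon> + \<epsilon>\<^sup>2)\<bar> \<le> K + c / 4 + B / 8 + 1 / 4"
    using K u by linarith
  have "\<bar>b * \<epsilon>\<bar> \<le> B * 1"
    unfolding abs_mult using \<epsilon> b B by (intro mult_mono) auto
  then have "c - B \<le> c - b * \<epsilon> + \<epsilon>\<^sup>2"
    using zero_le_power2[of \<epsilon>] by linarith
  then have p: "K + c / 4 + B / 8 + 1 / 4 < c - b * \<epsilon> + \<epsilon>\<^sup>2" (is "_ < ?p")
    using c B by linarith
  have "\<bar>z\<bar> < 1"
  proof (rule ccontr)
    assume "\<not> \<bar>z\<bar> < 1"
    then have "1 * ?p \<le> \<bar>z\<bar> * ?p"
      using p B c1 by (intro mult_right_mono) linarith+
    also have "\<dots> \<le> \<bar>z * ?p\<bar>" unfolding abs_mult by (intro mult_left_mono) auto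
    finally show False using p z by simp
  qed
  then have "v$3 = 0" by (simp add: z_def)
  then have "\<bar>y\<bar> < 1 / 4" using w by (simp add: w_def z_def)
  then have "v$2 = 0" by (simp add: y_def)
  with \<open>v$3 = 0\<close> show ?thesis by simp
qed

section \<open>The small root and orbits under multiplication by it\<close>

text \<open>Intermediate values on [0, \<eta>]: the cubic is -1 at 0 and nonnegative at \<eta> once
  s is large.\<close>

lemma cubic_small_root:
  fixes \<tau> \<eta> :: real
  assumes "0 < \<eta>"
  shows "\<exists>s0. \<forall>s\<ge>s0. \<exists>\<epsilon>. 0 < \<epsilon> \<and> \<epsilon> \<le> \<eta> \<and> \<epsilon> ^ 3 - \<tau> * \<epsilon>\<^sup>2 + s * \<epsilon> - 1 = 0"
proof (rule exI[of _ "(1 + \<bar>\<tau>\<bar> * \<eta>\<^sup>2) / \<eta>"], intro allI impI)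
  fix s assume "(1 + \<bar>\<tau>\<bar> * \<eta>\<^sup>2) / \<eta> \<le> s"
  then have "1 + \<bar>\<tau>\<bar> * \<eta>\<^sup>2 \<le> s * \<eta>"
    using assms by (simp add: field_simps)
  moreover have "\<tau> * \<eta>\<^sup>2 \<le> \<bar>\<tau>\<bar> * \<eta>\<^sup>2" by (intro mult_right_mono) auto
  moreover have "0 \<le> \<eta> ^ 3" using assms by simp
  ultimately have "0 \<le> \<eta> ^ 3 - \<tau> * \<eta>\<^sup>2 + s * \<eta> - 1" by linarith
  then have "\<exists>\<epsilon>\<ge>0. \<epsilon> \<le> \<eta> \<and> \<epsilon> ^ 3 - \<tau> * \<epsilon>\<^sup>2 + s * \<epsilon> - 1 = 0"
    using assms by (intro IVT') (auto intro!: continuous_intros)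
  then obtain \<epsilon> where e: "0 \<le> \<epsilon>" "\<epsilon> \<le> \<eta>" "\<epsilon> ^ 3 - \<tau> * \<epsilon>\<^sup>2 + s * \<epsilon> - 1 = 0"
    by blast
  have "0 < \<epsilon>" using e(1,3) by (cases "\<epsilon> = 0") auto
  with e(2,3) show "\<exists>\<epsilon>. 0 < \<epsilon> \<and> \<epsilon> \<le> \<eta> \<and> \<epsilon> ^ 3 - \<tau> * \<epsilon>\<^sup>2 + s * \<epsilon> - 1 = 0"
    by blast
qed

text \<open>The intervals from \<delta> c^k to \<delta> c^(k+1), for integer k, tile the positive
  reals. The two cases separate the signs of k, so only natural exponents occur.\<close>

lemma power_window_cases:
  fixes c r \<delta> :: real
  assumes "1 < c" "0 < r" "0 < \<delta>"
  obtains k where "\<delta> \<le> r * c ^ k" "r * c ^ k < \<delta> * c" | k where "\<delta> * c ^ k \<le> r" "r < \<delta> * c ^ Suc k"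
proof (cases "\<delta> \<le> r")
  case True
  define k where "k = (LEAST k. r / \<delta> < c ^ k)"
  obtain n where "r / \<delta> < c ^ n" using real_arch_pow[OF assms(1)] by blast
  then have k: "r / \<delta> < c ^ k" "\<And>j. j < k \<Longrightarrow> \<not> r / \<delta> < c ^ j"
    unfolding k_def by (auto intro: LeastI dest: not_less_Least)
  have "k \<noteq> 0" using k(1) True assms(3) by (intro notI) (simp add: field_simps)
  then obtain j where "k = Suc j" by (cases k) auto
  with k(1) k(2)[of j] assms(3) show ?thesis
    by (intro that(2)[of j]) (auto simp: field_simps)
next
  case False
  define k where "k = (LEAST k. \<delta> / r \<le> c ^ k)"
  obtain n where "\<delta> / r < c ^ n" using real_arch_pow[OF assms(1)] by blast
  then have "\<delta> / r \<le> c ^ n" by simp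
  then have k: "\<delta> / r \<le> c ^ k" "\<And>j. j < k \<Longrightarrow> \<not> \<delta> / r \<le> c ^ j"
    unfolding k_def by (auto intro: LeastI dest: not_less_Least)
  have "k \<noteq> 0" using k(1) False assms(2) by (intro notI) (simp add: field_simps)
  then obtain j where j: "k = Suc j" by (cases k) auto
  have "r * c ^ j < \<delta>" using k(2)[of j] j assms(2) by (simp add: field_simps)
  then have "r * c ^ k < \<delta> * c"
    using mult_strict_right_mono[of "r * c ^ j" \<delta> c] assms(1) j by (simp add: mult_ac)
  with k(1) assms(2) show ?thesis by (intro that(1)[of k]) (auto simp: field_simps)
qed

text \<open>\<open>R\<close> ranges over predicates that are invariant under multiplication by \<open>\<lambda>\<close>, which avoids
  speaking of integer powers of the companion matrix.\<close>

lemma companion3_orbit: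
  fixes \<tau> E :: int
  shows "\<exists>s0. \<forall>s\<ge>s0. \<forall>R v.
    (\<forall>v. R (companion3 \<tau> s *v v) \<longleftrightarrow> R v) \<longrightarrow> (\<forall>v. v$2 = 0 \<and> v$3 = 0 \<longrightarrow> R v) \<longrightarrow>
    det (krylov (companion3 \<tau> s) v) \<noteq> 0 \<longrightarrow> \<bar>det (krylov (companion3 \<tau> s) v)\<bar> \<le> E \<longrightarrow> R v"
proof -
  \<comment> \<open>\<open>B\<close> will bound the coefficient b, \<open>K\<close> the real factor
    once the quadratic one is at least 1/32, and c \<ge> \<open>C\<close> implies the size
    conditions of \<open>factors_small_imp\<close>.\<close>
  define B K where "B = \<bar>real_of_int \<tau>\<bar> + 1" and "K = 32 * \<bar>real_of_int E\<bar>"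
  define C where "C = 2 * K + 4 * B + B\<^sup>2 + 2"
  have pos: "1 \<le> B" "0 \<le> K" by (auto simp: B_def K_def)
  have "2 \<le> C" using pos zero_le_power2[of B] unfolding C_def by linarith
  then have "0 < 1 / C" by simp
  from cubic_small_root[OF this, of \<tau>] obtain s0 :: real where s0:
    "\<And>s::real. s \<ge> s0 \<Longrightarrow> \<exists>\<epsilon>::real. 0 < \<epsilon> \<and> \<epsilon> \<le> 1 / C \<and> \<epsilon> ^ 3 - \<tau> * \<epsilon>\<^sup>2 + s * \<epsilon> - 1 = 0"
    by blast
  show ?thesis
  proof (rule exI[of _ "\<lceil>s0\<rceil>"], intro allI impI)
    fix s :: int and R and v :: "int^3"
    let ?S = "companion3 \<tau> s"
    assume "\<lceil>s0\<rceil> \<le> s" and R_iff: "\<forall>v. R (?S *v v) \<longleftrightarrow> R v"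
      and R_base: "\<forall>v. v$2 = 0 \<and> v$3 = 0 \<longrightarrow> R v"
      and v: "det (krylov ?S v) \<noteq> 0" "\<bar>det (krylov ?S v)\<bar> \<le> E"
    then have "s0 \<le> s" by (simp add: ceiling_le_iff)
    from s0[OF this] obtain \<epsilon> :: real where \<epsilon>: "0 < \<epsilon>" "\<epsilon> \<le> 1 / C" "\<epsilon> ^ 3 - \<tau> * \<epsilon>\<^sup>2 + s * \<epsilon> - 1 = 0"
      by blast
    \<comment> \<open>The cubic factors as (X - \<epsilon>)(X^2 - bX + c).\<close>
    define c b where "c = 1 / \<epsilon>" and "b = \<tau> - \<epsilon>"
    have c\<epsilon>: "c * \<epsilon> = 1" using \<epsilon>(1) by (simp add: c_def)
    have \<tau>: "real_of_int \<tau> = b + \<epsilon>" by (simp add: b_def)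
    have "c = s - \<epsilon> * b"
    proof -
      have "(s - \<epsilon> * b) * \<epsilon> = 1"
        using \<epsilon>(3) by (simp add: b_def power2_eq_square power3_eq_cube algebra_simps)
      with \<epsilon>(1) show ?thesis by (simp add: c_def field_simps)
    qed
    then have s: "real_of_int s = c + \<epsilon> * b" by simp
    have "C \<le> c" using \<epsilon> \<open>2 \<le> C\<close> by (simp add: c_def field_simps)
    have "1 / C \<le> 1" using \<open>2 \<le> C\<close> by simp
    then have "\<epsilon> \<le> 1" using \<epsilon>(2) by linarith
    then have b: "\<bar>b\<bar> \<le> B" using \<epsilon>(1) by (simp add: b_def B_def)
    have B2: "B\<^sup>2 \<le> 2 * c" "K + 2 * B + 1 < 3 / 4 * c" "1 < c" "0 < c"
      using \<open>C \<le> c\<close> pos zero_le_power2[of B] unfolding C_def by linarith+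
    let ?Q = "quad_factor b c"
    have det_step: "det (krylov ?S (?S *v u)) = det (krylov ?S u)" for u
      using det_companion3[of \<tau> s] by (simp add: det_krylov_mult)
    have Q_step: "?Q (?S *v u) = c * ?Q u" for u
      by (rule quad_factor_companion3[OF \<tau> s c\<epsilon>])
    have window: "R u" if u: "det (krylov ?S u) \<noteq> 0" "\<bar>det (krylov ?S u)\<bar> \<le> E"
      "1 / 32 \<le> ?Q u" "?Q u < c / 32" for u
    proof -
      have "\<bar>real_factor \<epsilon> u\<bar> * ?Q u = \<bar>real_of_int (det (krylov ?S u))\<bar>"
        using det_krylov_companion3[OF \<tau> s c\<epsilon>, of u] u(3) by (simp add: abs_mult)
      moreover have "\<bar>real_of_int (det (krylov ?S u))\<bar> \<le> E"
        using u(2) by linarith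
      moreover have "\<bar>real_factor \<epsilon> u\<bar> * (1 / 32) \<le> \<bar>real_factor \<epsilon> u\<bar> * ?Q u"
        using u(3) by (intro mult_left_mono) auto
      ultimately have "\<bar>real_factor \<epsilon> u\<bar> \<le> K" by (simp add: K_def)
      then show ?thesis
        using factors_small_imp[OF \<epsilon>(1) \<open>\<epsilon> \<le> 1\<close> b B2(1,2) _ u(4)] R_base by blast
    qed
    have "?Q v \<noteq> 0" using det_krylov_companion3[OF \<tau> s c\<epsilon>, of v] v(1) by auto
    moreover have "?Q v \<ge> 0"
    proof -
      define u w :: real where "u = v$1 - c * v$3" and "w = v$2 + b * v$3"
      have "b\<^sup>2 \<le> B\<^sup>2" using b by (simp add: abs_le_square_iff[symmetric])
      then have "0 \<le> (u + b * w / 2)\<^sup>2 + (c - b\<^sup>2 / 4) * w\<^sup>2"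
        using B2 by (intro add_nonneg_nonneg mult_nonneg_nonneg) auto
      also have "\<dots> = ?Q v"
        by (simp add: quad_factor_def Let_def u_def w_def power2_eq_square algebra_simps)
      finally show ?thesis .
    qed
    ultimately have "0 < ?Q v" by simp
    \<comment> \<open>Each multiplication by the companion matrix scales the quadratic factor by c
      and keeps the determinant; \<open>up\<close> and \<open>down\<close> walk into the window from
      either side.\<close>
    have up: "R u" if "det (krylov ?S u) \<noteq> 0" "\<bar>det (krylov ?S u)\<bar> \<le> E"
      "1 / 32 \<le> ?Q u * c ^ k" "?Q u * c ^ k < 1 / 32 * c" for u k
      using that
    proof (induction k arbitrary: u)
      case 0
      then show ?case by (auto intro!: window)
    next
      case (Suc k)
      have "R (?S *v u)"
        using Suc.prems by (intro Suc.IH) (auto simp: det_step Q_step mult_ac)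
      then show ?case using R_iff by blast
    qed
    have down: "R u" if "det (krylov ?S u) \<noteq> 0" "\<bar>det (krylov ?S u)\<bar> \<le> E"
      "1 / 32 * c ^ k \<le> ?Q u" "?Q u < 1 / 32 * c ^ Suc k" for u k
      using that
    proof (induction k arbitrary: u)
      case 0
      then show ?case by (auto intro!: window)
    next
      case (Suc k)
      \<comment> \<open>The preimage under the companion matrix is integral since its determinant is
        1.\<close>
      define u' :: "int^3" where "u' = vector [u$2 + s * u$1, u$3 - \<tau> * u$1, u$1]"
      have u': "u = ?S *v u'"
        by (simp add: companion3_mult u'_def vec_eq_iff forall_3)
      have "R u'"
        using Suc.prems B2(4) unfolding u' by (intro Suc.IH) (auto simp: det_step Q_step)
      then show ?case using R_iff u' by blast
    qed
    from B2(3) \<open>0 < ?Q v\<close> show "R v"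
      by (rule power_window_cases[where \<delta> = "1 / 32"]) (use up[OF v] down[OF v] in auto)
  qed
qed


section \<open>From companion matrices to matrices of determinant one\<close>

text \<open>In the basis f, Nf, N^2 f the vector w has coordinates with denominator D, to which the
  orbit lemma applies. The matrix Z stands for an integer power of N. Keeping f arbitrary allows A^2
  e1 as well as e1.\<close>

lemma small_krylov_commuting:
  fixes \<tau> D :: int
  assumes "0 < D"
  shows "\<exists>s0. \<forall>N f w. det N = 1 \<longrightarrow> trace3 N = \<tau> \<longrightarrow> s0 \<le> minors3 N \<longrightarrow>
    \<bar>det (krylov N f)\<bar> = D \<longrightarrow> det (krylov N w) \<noteq> 0 \<longrightarrow> \<bar>det (krylov N w)\<bar> \<le> D \<longrightarrow>
    (\<exists>Z q. invertible Z \<and> Z ** N = N ** Z \<and> D *s (Z *v w) = q *s f)"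
proof -
  obtain s0 where s0: "\<And>s R v. s0 \<le> s \<Longrightarrow> (\<And>v. R (companion3 \<tau> s *v v) \<longleftrightarrow> R v) \<Longrightarrow>
    (\<And>v. v$2 = 0 \<Longrightarrow> v$3 = 0 \<Longrightarrow> R v) \<Longrightarrow> det (krylov (companion3 \<tau> s) v) \<noteq> 0 \<Longrightarrow>
    \<bar>det (krylov (companion3 \<tau> s) v)\<bar> \<le> D ^ 3 \<Longrightarrow> R v"
    using companion3_orbit[of \<tau> "D ^ 3"] by metis
  show ?thesis
  proof (rule exI[of _ s0], intro allI impI)
    fix N :: "int^3^3" and f w :: "int^3"
    assume N: "det N = 1" "trace3 N = \<tau>" "s0 \<le> minors3 N" and f: "\<bar>det (krylov N f)\<bar> = D"
      and w: "det (krylov N w) \<noteq> 0" "\<bar>det (krylov N w)\<bar> \<le> D"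
    let ?s = "minors3 N" and ?P = "krylov N f"
    let ?S = "companion3 \<tau> ?s"
    have NP: "N ** ?P = ?P ** ?S"
      using krylov_companion3[OF N(1), of f] N(2) by simp
    \<comment> \<open>\<open>R\<close> v: any integral w with scaled coordinates v is carried to the
      line of f by a unit commuting with N. Composing that unit with N or its inverse gives the
      invariance.\<close>
    define R where "R v \<longleftrightarrow> (\<forall>w. det ?P *s w = ?P *v v \<longrightarrow>
      (\<exists>Z q. invertible Z \<and> Z ** N = N ** Z \<and> det ?P *s (Z *v w) = q *s f))" for v
    have N_inv: "N ** adj3 N = mat 1" "adj3 N ** N = mat 1"
      using adj3_inverse N(1) by blast+
    then have inv: "invertible N" "invertible (adj3 N)"
      unfolding invertible_def by blast+
    have R_iff: "R (?S *v v) \<longleftrightarrow> R v" for v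
    proof
      assume *: "R (?S *v v)"
      show "R v" unfolding R_def
      proof (intro allI impI)
        fix w assume "det ?P *s w = ?P *v v"
        then have "det ?P *s (N *v w) = ?P *v (?S *v v)"
          by (metis NP matrix_vector_mult_smult3 matrix_vector_mul_assoc)
        with * obtain Z q where Z: "invertible Z" "Z ** N = N ** Z"
          "det ?P *s (Z *v (N *v w)) = q *s f"
          unfolding R_def by blast
        have "invertible (Z ** N)" "(Z ** N) ** N = N ** (Z ** N)"
          using Z(1) inv by (simp add: invertible_mult) (metis Z(2) matrix_mul_assoc)
        with Z(3) show "\<exists>Z q. invertible Z \<and> Z ** N = N ** Z \<and> det ?P *s (Z *v w) = q *s f"
          by (metis matrix_vector_mul_assoc)
      qed
    next
      assume *: "R v"
      show "R (?S *v v)" unfolding R_def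
      proof (intro allI impI)
        fix w assume "det ?P *s w = ?P *v (?S *v v)"
        then have "det ?P *s w = N *v (?P *v v)"
          by (metis NP matrix_vector_mul_assoc)
        then have "det ?P *s (adj3 N *v w) = ?P *v v"
          by (metis N_inv(2) matrix_vector_mult_smult3 matrix_vector_mul_assoc matrix_vector_mul_lid)
        with * obtain Z q where Z: "invertible Z" "Z ** N = N ** Z"
          "det ?P *s (Z *v (adj3 N *v w)) = q *s f"
          unfolding R_def by blast
        have "(Z ** adj3 N) ** N = Z"
          using N_inv by (simp add: matrix_mul_assoc[symmetric])
        moreover have "N ** (Z ** adj3 N) = Z"
          using N_inv Z(2) by (metis matrix_mul_assoc matrix_mul_rid)
        ultimately have "(Z ** adj3 N) ** N = N ** (Z ** adj3 N)" "invertible (Z ** adj3 N)"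
          using Z(1) inv by (simp_all add: invertible_mult)
        with Z(3) show "\<exists>Z q. invertible Z \<and> Z ** N = N ** Z \<and> det ?P *s (Z *v w) = q *s f"
          by (metis matrix_vector_mul_assoc)
      qed
    qed
    have R_base: "R v" if "v$2 = 0" "v$3 = 0" for v
    proof -
      have "?P *v v = v$1 *s f"
        using that by (simp add: krylov_def mat3_simps)
      moreover have "invertible (mat 1 :: int^3^3)" "mat 1 ** N = N ** mat 1" "mat 1 *v w = w"
        for w :: "int^3"
        by (auto simp: invertible_def)
      ultimately show ?thesis unfolding R_def by metis
    qed
    define v where "v = adj3 ?P *v w"
    have v: "det ?P *s w = ?P *v v" by (simp add: v_def mult_adj3)
    \<comment> \<open>Scaling w by det P cubes the factor, and P itself contributes one; hence the
      determinant of v is at most D^3, the bound chosen for the orbit lemma.\<close>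
    have "det ?P ^ 3 * det (krylov N w) = det ?P * det (krylov ?S v)"
      by (metis det_krylov_scale v krylov_intertwine[OF NP] det_mul)
    then have "\<bar>det ?P\<bar> ^ 3 * \<bar>det (krylov N w)\<bar> = \<bar>det ?P\<bar> * \<bar>det (krylov ?S v)\<bar>"
      by (metis abs_mult power_abs)
    then have "D * (D\<^sup>2 * \<bar>det (krylov N w)\<bar>) = D * \<bar>det (krylov ?S v)\<bar>"
      by (simp add: f power2_eq_square power3_eq_cube mult_ac)
    then have *: "\<bar>det (krylov ?S v)\<bar> = D\<^sup>2 * \<bar>det (krylov N w)\<bar>"
      using assms by (subst (asm) mult_cancel_left) auto
    also have "\<dots> \<le> D\<^sup>2 * D"
      using w(2) by (intro mult_left_mono) auto
    finally have "\<bar>det (krylov ?S v)\<bar> \<le> D ^ 3" by (simp add: power2_eq_square power3_eq_cube)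
    moreover have "det (krylov ?S v) \<noteq> 0" using * w(1) assms by auto
    ultimately have "R v" using s0[OF N(3), of R v] R_iff R_base by blast
    with v obtain Z q where Z: "invertible Z" "Z ** N = N ** Z" "det ?P *s (Z *v w) = q *s f"
      unfolding R_def by blast
    have "D *s (Z *v w) = q *s f \<or> D *s (Z *v w) = (- q) *s f"
    proof (cases "det ?P = D")
      case True
      with Z(3) show ?thesis by simp
    next
      case False
      then have "det ?P = - D" using f by linarith
      with Z(3) have "- D * (Z *v w)$i = q * f$i" for i
        by (metis vector_smult_component)
      then have "D * (Z *v w)$i = - q * f$i" for i
        by (metis minus_mult_left minus_minus)
      then show ?thesis by (simp add: vec_eq_iff)
    qed
    with Z(1,2) show "\<exists>Z q. invertible Z \<and> Z ** N = N ** Z \<and> D *s (Z *v w) = q *s f"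
      by blast
  qed
qed

section \<open>Rigidity of perfect Hessenberg matrices\<close>

lemma det_invertible_int:
  assumes "invertible (A :: int^3^3)"
  shows "det A = 1 \<or> det A = - 1"
proof -
  obtain B where "A ** B = mat 1" using assms unfolding invertible_def by blast
  then have "det A * det B = 1" by (metis det_I det_mul)
  then show ?thesis by (auto simp: zmult_eq_1_iff)
qed

lemma eq_if_sum_in_range:
  fixes a b p u :: int
  assumes "0 \<le> a" "a < p" "0 \<le> b" "b < p" "b = a + u * p"
  shows "u = 0"
proof -
  have "u * p < 1 * p" "(-1) * p < u * p" using assms by linarith+
  moreover have "0 < p" using assms by linarith
  ultimately show ?thesis by (simp only: mult_less_cancel_right_pos)
qed

text \<open>Preserving the line of e1 makes Y upper triangular with diagonal entries of modulus 1.
  Positive subdiagonals equate their signs, and the perfect ranges kill the entries above the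
  diagonal, so Y is plus or minus the identity.\<close>

lemma perfect_hessenberg_unique:
  fixes A B Y :: "int^3^3"
  assumes A: "perfect_hessenberg A" and B: "perfect_hessenberg B"
    and Y: "invertible Y" "B ** Y = Y ** A" and Y1: "Y$2$1 = 0" "Y$3$1 = 0"
  shows "A = B"
proof -
  have pos: "0 < A$2$1" "0 < B$2$1" "0 < A$3$2" "0 < B$3$2" "A$3$1 = 0" "B$3$1 = 0"
    using A B by (auto simp: perfect_hessenberg_def hessenberg_def)
  have eq: "B$i$1 * Y$1$j + B$i$2 * Y$2$j + B$i$3 * Y$3$j
      = Y$i$1 * A$1$j + Y$i$2 * A$2$j + Y$i$3 * A$3$j" for i j
    using arg_cong[OF Y(2), of "\<lambda>M. M$i$j"] by (simp add: matrix_matrix_mult_def sum_3)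
  have Y32: "Y$3$2 = 0" using eq[of 3 1] Y1 pos by simp
  have "det Y = Y$1$1 * (Y$2$2 * Y$3$3)" using Y1 Y32 by (simp add: det_3)
  then have "\<bar>Y$1$1\<bar> * (\<bar>Y$2$2\<bar> * \<bar>Y$3$3\<bar>) = 1"
    using det_invertible_int[OF Y(1)] by (auto simp flip: abs_mult)
  then have unit: "\<bar>Y$1$1\<bar> = 1" "\<bar>Y$2$2\<bar> = 1" "\<bar>Y$3$3\<bar> = 1"
    by (auto simp: zmult_eq_1_iff)
  define \<alpha> where "\<alpha> = Y$1$1"
  have \<alpha>: "\<alpha> = 1 \<or> \<alpha> = - 1" using unit(1) unfolding \<alpha>_def by linarith
  have Y22: "Y$2$2 = \<alpha>"
    using eq[of 2 1] Y1 pos unit \<alpha> by (auto simp: \<alpha>_def[symmetric] abs_if split: if_splits)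
  have "\<alpha> * B$1$1 = \<alpha> * A$1$1 + Y$1$2 * A$2$1" "\<alpha> * B$2$1 = \<alpha> * A$2$1"
    using eq[of 1 1] eq[of 2 1] Y1 pos Y22 by (auto simp: \<alpha>_def[symmetric] mult.commute)
  then have 1: "B$1$1 = A$1$1 + \<alpha> * Y$1$2 * A$2$1" "B$2$1 = A$2$1"
    using \<alpha> by auto
  \<comment> \<open>The (1,1) entries are congruent modulo the common (2,1) entry and both are
    reduced residues.\<close>
  then have "\<alpha> * Y$1$2 = 0"
    using A B by (intro eq_if_sum_in_range[of "A$1$1" "A$2$1" "B$1$1"]) (auto simp: perfect_hessenberg_def)
  then have Y12: "Y$1$2 = 0" using \<alpha> by auto
  have Y33: "Y$3$3 = \<alpha>"
    using eq[of 3 2] Y1 Y32 Y22 pos unit \<alpha> by (auto simp: abs_if split: if_splits)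
  have "\<alpha> * B$1$2 = \<alpha> * A$1$2 + Y$1$3 * A$3$2" "\<alpha> * B$2$2 = \<alpha> * A$2$2 + Y$2$3 * A$3$2"
    "\<alpha> * B$3$2 = \<alpha> * A$3$2"
    using eq[of 1 2] eq[of 2 2] eq[of 3 2] Y1 pos Y12 Y22 Y32 Y33
    by (auto simp: \<alpha>_def[symmetric] mult.commute)
  then have 2: "B$1$2 = A$1$2 + \<alpha> * Y$1$3 * A$3$2" "B$2$2 = A$2$2 + \<alpha> * Y$2$3 * A$3$2" "B$3$2 = A$3$2"
    using \<alpha> by auto
  have "\<alpha> * Y$1$3 = 0"
    using A B 2 by (intro eq_if_sum_in_range[of "A$1$2" "A$3$2" "B$1$2"]) (auto simp: perfect_hessenberg_def)
  moreover have "\<alpha> * Y$2$3 = 0"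
    using A B 2 by (intro eq_if_sum_in_range[of "A$2$2" "A$3$2" "B$2$2"]) (auto simp: perfect_hessenberg_def)
  ultimately have Y3: "Y$1$3 = 0" "Y$2$3 = 0" using \<alpha> by auto
  have "B$i$j * \<alpha> = \<alpha> * A$i$j" for i j
    using exhaust_3[of i] exhaust_3[of j] eq[of i j]
    by (elim disjE) (simp_all add: Y1 Y12 Y32 Y22 Y33 Y3 \<alpha>_def[symmetric])
  then have "B$i$j = A$i$j" for i j
    using \<alpha> by (metis mult.commute mult_cancel_left zero_neq_neg_one zero_neq_one)
  then show ?thesis by (simp add: vec_eq_iff)
qed

text \<open>As Z commutes with A, the product Z X' still conjugates B to A, and it preserves the
  line of e1.\<close>

lemma perfect_hessenberg_unique_commuting:
  fixes A B X Z :: "int^3^3"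
  assumes A: "perfect_hessenberg A" and B: "perfect_hessenberg B"
    and X: "X ** X' = mat 1" "X' ** X = mat 1" "B = X ** A ** X'"
    and Z: "invertible Z" "Z ** A = A ** Z" and D: "D \<noteq> 0" "D *s (Z *v (X' *v axis 1 1)) = q *s axis 1 1"
  shows "A = B"
proof -
  define Y where "Y = Z ** X'"
  have "invertible Y"
    unfolding Y_def using X Z(1) by (intro invertible_mult) (auto simp: invertible_def)
  moreover have "A ** Y = Y ** B"
    unfolding Y_def X(3) using X(2) Z(2) by (metis matrix_mul_assoc matrix_mul_rid)
  moreover have "Y$2$1 = 0" "Y$3$1 = 0"
  proof -
    have "D *s (Y *v axis 1 1) = q *s axis 1 1" using D(2) by (simp add: Y_def matrix_vector_mul_assoc)
    then have "D * (Y *v axis 1 1)$2 = 0 \<and> D * (Y *v axis 1 1)$3 = 0"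
      by (simp add: vec_eq_iff axis_def forall_3)
    with D(1) show "Y$2$1 = 0" "Y$3$1 = 0" by (simp_all add: mat3_simps axis_def)
  qed
  ultimately show ?thesis using perfect_hessenberg_unique[OF B A] by blast
qed

section \<open>Complexity and integer conjugation\<close>

text \<open>The Krylov matrix at e1 is upper triangular with diagonal 1, a21, a21 a32.\<close>

lemma det_krylov_hessenberg:
  assumes "hessenberg A"
  shows "det (krylov A (axis 1 1)) = hessenberg_complexity A"
  using assms by (simp add: krylov_def det_3 mat3_simps axis_def hessenberg_def hessenberg_complexity_def
      power2_eq_square)

lemma det_krylov_conjugate:
  fixes A B X :: "int^3^3"
  assumes X: "X ** X' = mat 1" "X' ** X = mat 1" "B = X ** A ** X'"
  shows "\<bar>det (krylov A (X' *v w))\<bar> = \<bar>det (krylov B w)\<bar>"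
proof -
  have "A ** X' = X' ** B"
    unfolding X(3) using X(2) by (metis matrix_mul_assoc matrix_mul_lid)
  moreover have "det X' = 1 \<or> det X' = - 1"
    by (rule det_invertible_int) (use X in \<open>auto simp: invertible_def\<close>)
  ultimately show ?thesis by (auto simp: krylov_intertwine det_mul)
qed

lemma integer_conjugateE:
  assumes "integer_conjugate A B"
  obtains X X' where "X ** X' = mat 1" "X' ** X = mat 1" "B = X ** A ** X'"
proof -
  obtain X where X: "invertible X" "B = X ** A ** matrix_inv X"
    using assms unfolding integer_conjugate_def by blast
  have *: "X ** matrix_inv X = mat 1 \<and> matrix_inv X ** X = mat 1"
    using X(1) unfolding invertible_def matrix_inv_def by (rule someI_ex)
  show ?thesis by (rule that[OF _ _ X(2)]) (use * in simp_all)
qed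

lemma matrix_inv_eqI:
  assumes "X ** X' = mat 1" "X' ** X = mat (1::int)"
  shows "matrix_inv X = X'"
proof -
  have "X ** matrix_inv X = mat 1 \<and> matrix_inv X ** X = mat 1"
    unfolding matrix_inv_def by (rule someI[of _ X']) (use assms in simp)
  then show ?thesis using assms by (metis matrix_mul_assoc matrix_mul_lid matrix_mul_rid)
qed

lemma integer_conjugate_sym:
  assumes "integer_conjugate A B"
  shows "integer_conjugate B A"
proof -
  obtain X X' where X: "X ** X' = mat 1" "X' ** X = mat 1" "B = X ** A ** X'"
    using assms by (rule integer_conjugateE)
  have "A = X' ** B ** X"
    unfolding X(3) using X(2) by (metis matrix_mul_assoc matrix_mul_lid matrix_mul_rid)
  then show ?thesis
    unfolding integer_conjugate_def using matrix_inv_eqI[OF X(2,1)] X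
    by (intro exI[of _ X']) (auto simp: invertible_def)
qed

section \<open>Strict minimality within a conjugacy class\<close>

text \<open>Comparing with \<le> makes A the unique minimiser, which yields both claims of the
  theorem at once.\<close>

definition strictly_minimal :: "int^3^3 \<Rightarrow> bool" where
  "strictly_minimal A \<longleftrightarrow> (\<forall>B. perfect_hessenberg B \<longrightarrow> integer_conjugate A B \<longrightarrow>
     hessenberg_complexity B \<le> hessenberg_complexity A \<longrightarrow> B = A)"

lemma strictly_minimalI:
  fixes A N :: "int^3^3"
  assumes A: "perfect_hessenberg A"
    and small: "\<And>w. det (krylov A w) \<noteq> 0 \<Longrightarrow> \<bar>det (krylov A w)\<bar> \<le> hessenberg_complexity A \<Longrightarrow>
      \<exists>Z q. invertible Z \<and> Z ** A = A ** Z \<and> hessenberg_complexity A *s (Z *v w) = q *s axis 1 1"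
  shows "strictly_minimal A"
  unfolding strictly_minimal_def
proof (intro allI impI)
  fix B
  assume B: "perfect_hessenberg B" "integer_conjugate A B"
    and le: "hessenberg_complexity B \<le> hessenberg_complexity A"
  obtain X X' where X: "X ** X' = mat 1" "X' ** X = mat 1" "B = X ** A ** X'"
    using B(2) by (rule integer_conjugateE)
  have pos: "0 < hessenberg_complexity B" "0 < hessenberg_complexity A"
    using A B(1) by (auto simp: perfect_hessenberg_def hessenberg_complexity_def)
  have "\<bar>det (krylov A (X' *v axis 1 1))\<bar> = hessenberg_complexity B"
    using det_krylov_conjugate[OF X] B(1) pos by (simp add: det_krylov_hessenberg perfect_hessenberg_def)
  then have "det (krylov A (X' *v axis 1 1)) \<noteq> 0"
    "\<bar>det (krylov A (X' *v axis 1 1))\<bar> \<le> hessenberg_complexity A"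
    using le pos by auto
  then obtain Z q where Z: "invertible Z" "Z ** A = A ** Z"
    "hessenberg_complexity A *s (Z *v (X' *v axis 1 1)) = q *s axis 1 1"
    using small[of "X' *v axis 1 1"] by blast
  show "B = A"
    using perfect_hessenberg_unique_commuting[OF A B(1) X Z(1,2) _ Z(3)] pos by simp
qed

text \<open>The threshold depends only on \<tau> and D, so it serves all matrices of a ray
  simultaneously.\<close>

lemma strictly_minimal_minors:
  fixes \<tau> D :: int
  shows "\<exists>s0. \<forall>A. perfect_hessenberg A \<longrightarrow> hessenberg_complexity A = D \<longrightarrow> trace3 A = \<tau> \<longrightarrow>
    s0 \<le> minors3 A \<longrightarrow> strictly_minimal A"
proof (cases "0 < D")
  case True
  from small_krylov_commuting[OF this, of \<tau>] obtain s0 where s0: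
    "\<And>N f w. det N = 1 \<Longrightarrow> trace3 N = \<tau> \<Longrightarrow> s0 \<le> minors3 N \<Longrightarrow>
      \<bar>det (krylov N f)\<bar> = D \<Longrightarrow> det (krylov N w) \<noteq> 0 \<Longrightarrow> \<bar>det (krylov N w)\<bar> \<le> D \<Longrightarrow>
      \<exists>Z q. invertible Z \<and> Z ** N = N ** Z \<and> D *s (Z *v w) = q *s f"
    by blast
  show ?thesis
  proof (rule exI[of _ s0], intro allI impI)
    fix A :: "int^3^3"
    assume A: "perfect_hessenberg A" "hessenberg_complexity A = D" "trace3 A = \<tau>" "s0 \<le> minors3 A"
    then have "hessenberg A" "det A = 1" by (simp_all add: perfect_hessenberg_def hessenberg_def)
    with A True have "\<bar>det (krylov A (axis 1 1))\<bar> = D" by (simp add: det_krylov_hessenberg)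
    with A \<open>det A = 1\<close> show "strictly_minimal A"
      using s0 by (intro strictly_minimalI) simp_all
  qed
next
  case False
  then show ?thesis
    by (auto simp: perfect_hessenberg_def hessenberg_complexity_def intro!: exI[of _ 0])
qed

text \<open>The previous argument for the inverse N of A, with f = A^2 e1, whose Krylov triple under
  N is A^2 e1, A e1, e1.\<close>

lemma strictly_minimal_trace:
  fixes \<sigma> D :: int
  shows "\<exists>s0. \<forall>A. perfect_hessenberg A \<longrightarrow> hessenberg_complexity A = D \<longrightarrow> minors3 A = \<sigma> \<longrightarrow>
    s0 \<le> trace3 A \<longrightarrow> strictly_minimal A"
proof (cases "0 < D")
  case True
  from small_krylov_commuting[OF this, of \<sigma>] obtain s0 where s0:
    "\<And>N f w. det N = 1 \<Longrightarrow> trace3 N = \<sigma> \<Longrightarrow> s0 \<le> minors3 N \<Longrightarrow>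
      \<bar>det (krylov N f)\<bar> = D \<Longrightarrow> det (krylov N w) \<noteq> 0 \<Longrightarrow> \<bar>det (krylov N w)\<bar> \<le> D \<Longrightarrow>
      \<exists>Z q. invertible Z \<and> Z ** N = N ** Z \<and> D *s (Z *v w) = q *s f"
    by blast
  show ?thesis
  proof (rule exI[of _ s0], intro allI impI)
    fix A :: "int^3^3"
    assume A: "perfect_hessenberg A" "hessenberg_complexity A = D" "minors3 A = \<sigma>" "s0 \<le> trace3 A"
    then have hA: "hessenberg A" "det A = 1" by (simp_all add: perfect_hessenberg_def hessenberg_def)
    let ?N = "adj3 A" and ?f = "A *v (A *v axis 1 1)"
    have inv: "A ** ?N = mat 1" "?N ** A = mat 1"
      using adj3_inverse hA(2) by blast+
    then have dN: "det ?N = 1" using hA(2) by (metis det_I det_mul mult_1)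
    have dk: "\<bar>det (krylov ?N w)\<bar> = \<bar>det (krylov A w)\<bar>" for w
      by (simp add: det_krylov_inverse[OF hA(2) inv(1)])
    have f: "\<bar>det (krylov ?N ?f)\<bar> = D"
      using A(2) True hA by (simp add: dk det_krylov_mult det_krylov_hessenberg)
    show "strictly_minimal A"
    proof (rule strictly_minimalI[OF A(1)])
      fix w assume "det (krylov A w) \<noteq> 0" "\<bar>det (krylov A w)\<bar> \<le> hessenberg_complexity A"
      then have "det (krylov ?N w) \<noteq> 0" "\<bar>det (krylov ?N w)\<bar> \<le> D"
        using dk[of w] A(2) by auto
      then obtain Z q where Z: "invertible Z" "Z ** ?N = ?N ** Z" "D *s (Z *v w) = q *s ?f"
        using s0[OF dN _ _ f, of w] A(3,4) hA(2) by (auto simp: trace3_adj3 minors3_adj3)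
      have ZA: "Z ** A = A ** Z"
        using Z(2) inv by (metis matrix_mul_assoc matrix_mul_lid matrix_mul_rid)
      \<comment> \<open>Two further factors N move the line of A^2 e1 back to that of e1.\<close>
      let ?Z = "?N ** (?N ** Z)"
      have "invertible ?Z"
        using inv Z(1) by (intro invertible_mult) (auto simp: invertible_def)
      moreover have "?Z ** A = A ** ?Z"
        using ZA Z(2) inv by (metis matrix_mul_assoc matrix_mul_lid matrix_mul_rid)
      moreover have "D *s (?Z *v w) = q *s axis 1 1"
      proof -
        have "D *s (?Z *v w) = ?N *v (?N *v (D *s (Z *v w)))"
          by (simp add: matrix_vector_mult_smult3 matrix_vector_mul_assoc)
        also have "\<dots> = q *s (?N *v (?N *v (A *v (A *v axis 1 1))))"
          unfolding Z(3) by (simp add: matrix_vector_mult_smult3)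
        also have "\<dots> = q *s axis 1 1"
          by (simp only: mult_adj3 hA(2) matrix_vector_mult_smult3) simp
        finally show ?thesis .
      qed
      ultimately show "\<exists>Z q. invertible Z \<and> Z ** A = A ** Z \<and>
          hessenberg_complexity A *s (Z *v w) = q *s axis 1 1"
        using A(2) by blast
    qed
  qed
next
  case False
  then show ?thesis
    by (auto simp: perfect_hessenberg_def hessenberg_complexity_def intro!: exI[of _ 0])
qed

lemma strictly_minimal_imp_reduced:
  assumes A: "perfect_hessenberg A" "strictly_minimal A"
  shows "\<not> sigma_nonreduced A"
    and "sigma_reduced B \<Longrightarrow> integer_conjugate A B \<Longrightarrow> B = A"
proof -
  have "hessenberg_complexity A \<le> hessenberg_complexity B"
    if "perfect_hessenberg B" "integer_conjugate A B" for B
    using A(2) that linear unfolding strictly_minimal_def by metis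
  then have "sigma_reduced A" using A(1) unfolding sigma_reduced_def by blast
  then show "\<not> sigma_nonreduced A" by (simp add: sigma_nonreduced_def)
  show "B = A" if B: "sigma_reduced B" "integer_conjugate A B"
  proof -
    have "hessenberg_complexity B \<le> hessenberg_complexity A"
      using B(1) A(1) integer_conjugate_sym[OF B(2)] unfolding sigma_reduced_def by simp
    with B show ?thesis using A(2) unfolding strictly_minimal_def sigma_reduced_def by blast
  qed
qed

section \<open>Growth of the characteristic coefficients along the two rays\<close>

theorem mainTheorem3:
  fixes a11 a12 a13 a21 a22 a23 a32 a33 m n :: int
    and H :: "int \<Rightarrow> int \<Rightarrow> int^3^3"
    and M :: "nat \<Rightarrow> int^3^3"
  assumes "0 \<le> a11" "a11 < a21"
    and "0 \<le> a12" "a12 < a32"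
    and "0 \<le> a22" "a22 < a32"
    and "det (hess_mat a11 a12 a13 a21 a22 a23 a32 a33) = 1"
    and H_eq: "H = hess_family a11 a12 a13 a21 a22 a23 a32 a33"
    and M_eq: "(\<forall>t. M t = H (m - int t) n) \<or>
               (\<forall>t. M t = H (m + a11 * int t) (n + a21 * int t))"
    and NRS_ray: "\<forall>t. NRS (M t)"
  shows "finite {t. sigma_nonreduced (M t)} \<and>
         finite {t. \<exists>A B. A \<noteq> B \<and> sigma_reduced A \<and> sigma_reduced B \<and>
                          integer_conjugate (M t) A \<and> integer_conjugate (M t) B}"
proof -
  have perfect: "perfect_hessenberg (H i j)" for i j
    using assms(1-7) by (simp add: H_eq perfect_hessenberg_def hessenberg_def hess_family_def hess_mat_def det_3)
      (simp add: algebra_simps)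
  have complexity: "hessenberg_complexity (H i j) = a21\<^sup>2 * a32" for i j
    by (simp add: H_eq hessenberg_complexity_def hess_family_def hess_mat_def)
  have trace: "trace3 (H i j) = a11 + a22 + a33 + a32 * j" for i j
    by (simp add: H_eq trace3_def hess_family_def hess_mat_def)
  have minors: "minors3 (H i j) = a11 * a22 - a12 * a21 + (a11 + a22) * a33 - a23 * a32
      + a32 * (a11 * j - a21 * i)" for i j
    by (simp add: H_eq minors3_def hess_family_def hess_mat_def algebra_simps)
  have pos: "1 \<le> a21 * a32" using assms(1-6) by (simp add: int_one_le_iff_zero_less)
  have large: "k \<le> c + a21 * a32 * int t" if "nat (k - c) \<le> t" for k c t
  proof -
    have "k - c \<le> 1 * int t" using that by linarith
    also have "\<dots> \<le> a21 * a32 * int t" using pos by (intro mult_right_mono) auto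
    finally show ?thesis by linarith
  qed
  have "\<exists>T. \<forall>t\<ge>T. strictly_minimal (M t)"
    using M_eq
  proof
    assume M: "\<forall>t. M t = H (m - int t) n"
    obtain s0 where s0: "\<And>A. perfect_hessenberg A \<Longrightarrow> hessenberg_complexity A = a21\<^sup>2 * a32 \<Longrightarrow>
      trace3 A = a11 + a22 + a33 + a32 * n \<Longrightarrow> s0 \<le> minors3 A \<Longrightarrow> strictly_minimal A"
      using strictly_minimal_minors by metis
    \<comment> \<open>The trace depends only on the second parameter, fixed here, while the minors
      grow linearly.\<close>
    have "minors3 (M t) = minors3 (H m n) + a21 * a32 * int t" for t
      by (simp add: M minors algebra_simps)
    then have "strictly_minimal (M t)" if "nat (s0 - minors3 (H m n)) \<le> t" for t
      using large[OF that] by (intro s0) (auto simp: M perfect complexity trace)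
    then show ?thesis by blast
  next
    assume M: "\<forall>t. M t = H (m + a11 * int t) (n + a21 * int t)"
    obtain s0 where s0: "\<And>A. perfect_hessenberg A \<Longrightarrow> hessenberg_complexity A = a21\<^sup>2 * a32 \<Longrightarrow>
      minors3 A = minors3 (H m n) \<Longrightarrow> s0 \<le> trace3 A \<Longrightarrow> strictly_minimal A"
      using strictly_minimal_trace by metis
    \<comment> \<open>The direction (a11, a21) annihilates a11 j - a21 i, so the minors stay fixed
      while the trace grows.\<close>
    have "trace3 (M t) = trace3 (H m n) + a21 * a32 * int t" for t
      by (simp add: M trace algebra_simps)
    then have "strictly_minimal (M t)" if "nat (s0 - trace3 (H m n)) \<le> t" for t
      using large[OF that] by (intro s0) (auto simp: M perfect complexity minors algebra_simps)
    then show ?thesis by blast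
  qed
  then obtain T where T: "\<And>t. T \<le> t \<Longrightarrow> strictly_minimal (M t)" by blast
  have perfect_M: "perfect_hessenberg (M t)" for t using M_eq perfect by auto
  have unique: "A = B"
    if "T \<le> t" "sigma_reduced A" "sigma_reduced B" "integer_conjugate (M t) A" "integer_conjugate (M t) B"
    for t A B
    using strictly_minimal_imp_reduced(2)[OF perfect_M T[OF that(1)]] that(2-5) by metis
  show ?thesis
  proof (intro conjI finite_subset[OF _ finite_lessThan[of T]] subsetI)
    fix t assume "t \<in> {t. sigma_nonreduced (M t)}"
    then show "t \<in> {..<T}"
      using strictly_minimal_imp_reduced(1)[OF perfect_M T, of t] by force
  next
    fix t
    assume "t \<in> {t. \<exists>A B. A \<noteq> B \<and> sigma_reduced A \<and> sigma_reduced B \<and>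
      integer_conjugate (M t) A \<and> integer_conjugate (M t) B}"
    then obtain A B where "A \<noteq> B" "sigma_reduced A" "sigma_reduced B"
      "integer_conjugate (M t) A" "integer_conjugate (M t) B"
      by blast
    with unique[of t A B] show "t \<in> {..<T}" by force
  qed
qed

end
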